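(* Let $A$ be a g-alternative algebra over a field $F$. If $\mathrm{Asoci}(A)=0$, then the action of $\mathfrak{B}(A)$ on $A$ is a derived action in $\mathrm{gAlt}$.
   Context: Algebras: an algebra over a field $F$ is an $F$-vector space with an $F$-bilinear multiplication, not assumed associative or unital. $A$ is g-alternative if for all $x,y,z\in A$: $x(yz)=(xy)z+(yx)z-y(xz)$ and $(xy)z=x(yz)+x(zy)-(xz)y$. $\mathrm{gAlt}$ is the category of g-alternative algebras over $F$. Derived actions: an action of an $F$-algebra $B$ on a g-alternative algebra $A$, i.e. a pair of $F$-bilinear maps $B\times A\to A$, $(b,a)\mapsto ba$, and $A\times B\to A$, $(a,b)\mapsto ab$, is a derived action in $\mathrm{gAlt}$ if $B$ is g-alternative and for all $a,a_1,a_2\in A$, $b,b_1,b_2\in B$: $b(a_1a_2)=(ba_1)a_2+(a_1b)a_2-a_1(ba_2)$; $(a_1a_2)b=a_1(a_2b)+a_1(ba_2)-(a_1b)a_2$; $(ba_1)a_2=b(a_1a_2)+b(a_2a_1)-(ba_2)a_1$; $a_1(a_2b)=(a_1a_2)b+(a_2a_1)b-a_2(a_1b)$; $(b_1b_2)a=b_1(b_2a)+b_1(ab_2)-(b_1a)b_2$; $a(b_1b_2)=(ab_1)b_2+(b_1a)b_2-b_1(ab_2)$; $(ab_1)b_2=a(b_1b_2)+a(b_2b_1)-(ab_2)b_1$; $b_1(b_2a)=(b_1b_2)a+(b_2b_1)a-b_2(b_1a)$. ($A$ acts on itself by multiplication.) Let $\{B_i\}_{i\in I}$ be the family of all g-alternative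 algebras equipped with a derived action on $A$ in $\mathrm{gAlt}$. $\mathfrak{B}(A)$: for a pair $f$ of $F$-linear maps $A\to A$ write $fa$ for the value of the first map at $a$ and $af$ for the value of the second. Each $b\in B_i$ gives the pair $(a\mapsto ba,\ a\mapsto ab)$; let $\mathbb{B}$ be the set of all pairs so obtained. On pairs define addition componentwise and a product $ff'$ by $(ff')a=f(f'a)+f(af')-(fa)f'$, $a(ff')=(af)f'+(fa)f'-f(af')$. Then $\mathfrak{B}(A)$ (the universal strict general actor of $A$) is the $F$-algebra of all pairs obtained from elements of $\mathbb{B}$ by repeatedly applying addition, negation and this product (pairs giving the same maps are identified). It acts on $A$ by $(f,a)\mapsto fa$, $(a,f)\mapsto af$. Substructure: a $\mathfrak{B}(A)$-substructure of $A$ is a subalgebra $A'\subseteq A$ with $fa\in A'$ and $af\in A'$ for all $f\in\mathfrak{B}(A)$, $a\in A'$. $\mathrm{Soci}(A)$ is the $\mathfrak{B}(A)$-substructure of $A$ generated by all elements of the forms $x(yz)+x(zy)$ and $(yz)x+(zy)x$ in which one of $x,y,z$ lies in $\bigcup_{i\in I}B_i$ and the other two lie in $A$. For $n\ge1$, $\mathrm{Asoci}^n(A)=\{x\in A\mid (\dots((xa_1)a_2)\dots)a_n\in\mathrm{Soci}(A)\text{ for all }a_1,\dots,a_n\in A\}$, and $\mathrm{Asoci}(A)=\bigcup_{n\ge1}\mathrm{Asoci}^n(A)$. *)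

theory Defs
  imports "HOL-Algebra.Module"
begin

text \<open>
  Vector spaces over a field are modules over it in the sense of HOL-Algebra. An algebra, not
  assumed associative or unital, is carried by a record of type \<^type>\<open>module\<close>; the field
  \<^const>\<open>one\<close> of that record plays no role.
\<close>

definition bilinear_op ::
    "('f, 'r) ring_scheme \<Rightarrow> ('f, 'u, 'k) module_scheme \<Rightarrow> ('f, 'v, 'm) module_scheme \<Rightarrow>
     ('f, 'w, 'n) module_scheme \<Rightarrow> ('u \<Rightarrow> 'v \<Rightarrow> 'w) \<Rightarrow> bool" where
  "bilinear_op F U V W f \<longleftrightarrow>
     (\<forall>u \<in> carrier U. \<forall>v \<in> carrier V. f u v \<in> carrier W) \<and>
     (\<forall>u \<in> carrier U. \<forall>u' \<in> carrier U. \<forall>v \<in> carrier V.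
        f (u \<oplus>\<^bsub>U\<^esub> u') v = f u v \<oplus>\<^bsub>W\<^esub> f u' v) \<and>
     (\<forall>u \<in> carrier U. \<forall>v \<in> carrier V. \<forall>v' \<in> carrier V.
        f u (v \<oplus>\<^bsub>V\<^esub> v') = f u v \<oplus>\<^bsub>W\<^esub> f u v') \<and>
     (\<forall>c \<in> carrier F. \<forall>u \<in> carrier U. \<forall>v \<in> carrier V.
        f (c \<odot>\<^bsub>U\<^esub> u) v = c \<odot>\<^bsub>W\<^esub> f u v) \<and>
     (\<forall>c \<in> carrier F. \<forall>u \<in> carrier U. \<forall>v \<in> carrier V.
        f u (c \<odot>\<^bsub>V\<^esub> v) = c \<odot>\<^bsub>W\<^esub> f u v)"

locale nonassoc_algebra = F?: field F + module F A for F (structure) and A (structure) +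
  assumes mult_bilinear: "bilinear_op F A A A (\<lambda>x y. x \<otimes>\<^bsub>A\<^esub> y)"

locale g_alternative = nonassoc_algebra F A for F (structure) and A (structure) +
  assumes g_alt_left:
    "\<lbrakk>x \<in> carrier A; y \<in> carrier A; z \<in> carrier A\<rbrakk> \<Longrightarrow>
      x \<otimes>\<^bsub>A\<^esub> (y \<otimes>\<^bsub>A\<^esub> z) =
        (x \<otimes>\<^bsub>A\<^esub> y) \<otimes>\<^bsub>A\<^esub> z \<oplus>\<^bsub>A\<^esub> (y \<otimes>\<^bsub>A\<^esub> x) \<otimes>\<^bsub>A\<^esub> z \<ominus>\<^bsub>A\<^esub> y \<otimes>\<^bsub>A\<^esub> (x \<otimes>\<^bsub>A\<^esub> z)"
  and g_alt_right:
    "\<lbrakk>x \<in> carrier A; y \<in> carrier A; z \<in> carrier A\<rbrakk> \<Longrightarrow>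
      (x \<otimes>\<^bsub>A\<^esub> y) \<otimes>\<^bsub>A\<^esub> z =
        x \<otimes>\<^bsub>A\<^esub> (y \<otimes>\<^bsub>A\<^esub> z) \<oplus>\<^bsub>A\<^esub> x \<otimes>\<^bsub>A\<^esub> (z \<otimes>\<^bsub>A\<^esub> y) \<ominus>\<^bsub>A\<^esub> (x \<otimes>\<^bsub>A\<^esub> z) \<otimes>\<^bsub>A\<^esub> y"

text \<open>Here \<open>b \<triangleright> a\<close> and \<open>a \<triangleleft> b\<close> are the products \<open>ba\<close> and \<open>ab\<close> of \<open>b\<close> in \<open>B\<close> and \<open>a\<close> in \<open>A\<close>.\<close>

locale derived_action = B: g_alternative F B + A: g_alternative F A
  for F :: "('f, 'r) ring_scheme"
    and B :: "('f, 'b, 'n) module_scheme"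
    and A :: "('f, 'a, 'm) module_scheme" +
  fixes lact :: "'b \<Rightarrow> 'a \<Rightarrow> 'a" (infixl "\<triangleright>" 75)
    and ract :: "'a \<Rightarrow> 'b \<Rightarrow> 'a" (infixl "\<triangleleft>" 75)
  assumes lact_bilinear: "bilinear_op F B A A lact"
    and ract_bilinear: "bilinear_op F A B A ract"
    and act1: "\<lbrakk>b \<in> carrier B; a\<^sub>1 \<in> carrier A; a\<^sub>2 \<in> carrier A\<rbrakk> \<Longrightarrow>
      b \<triangleright> (a\<^sub>1 \<otimes>\<^bsub>A\<^esub> a\<^sub>2) =
        (b \<triangleright> a\<^sub>1) \<otimes>\<^bsub>A\<^esub> a\<^sub>2 \<oplus>\<^bsub>A\<^esub> (a\<^sub>1 \<triangleleft> b) \<otimes>\<^bsub>A\<^esub> a\<^sub>2 \<ominus>\<^bsub>A\<^esub> a\<^sub>1 \<otimes>\<^bsub>A\<^esub> (b \<triangleright> a\<^sub>2)"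
    and act2: "\<lbrakk>b \<in> carrier B; a\<^sub>1 \<in> carrier A; a\<^sub>2 \<in> carrier A\<rbrakk> \<Longrightarrow>
      (a\<^sub>1 \<otimes>\<^bsub>A\<^esub> a\<^sub>2) \<triangleleft> b =
        a\<^sub>1 \<otimes>\<^bsub>A\<^esub> (a\<^sub>2 \<triangleleft> b) \<oplus>\<^bsub>A\<^esub> a\<^sub>1 \<otimes>\<^bsub>A\<^esub> (b \<triangleright> a\<^sub>2) \<ominus>\<^bsub>A\<^esub> (a\<^sub>1 \<triangleleft> b) \<otimes>\<^bsub>A\<^esub> a\<^sub>2"
    and act3: "\<lbrakk>b \<in> carrier B; a\<^sub>1 \<in> carrier A; a\<^sub>2 \<in> carrier A\<rbrakk> \<Longrightarrow>
      (b \<triangleright> a\<^sub>1) \<otimes>\<^bsub>A\<^esub> a\<^sub>2 =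
        b \<triangleright> (a\<^sub>1 \<otimes>\<^bsub>A\<^esub> a\<^sub>2) \<oplus>\<^bsub>A\<^esub> b \<triangleright> (a\<^sub>2 \<otimes>\<^bsub>A\<^esub> a\<^sub>1) \<ominus>\<^bsub>A\<^esub> (b \<triangleright> a\<^sub>2) \<otimes>\<^bsub>A\<^esub> a\<^sub>1"
    and act4: "\<lbrakk>b \<in> carrier B; a\<^sub>1 \<in> carrier A; a\<^sub>2 \<in> carrier A\<rbrakk> \<Longrightarrow>
      a\<^sub>1 \<otimes>\<^bsub>A\<^esub> (a\<^sub>2 \<triangleleft> b) =
        (a\<^sub>1 \<otimes>\<^bsub>A\<^esub> a\<^sub>2) \<triangleleft> b \<oplus>\<^bsub>A\<^esub> (a\<^sub>2 \<otimes>\<^bsub>A\<^esub> a\<^sub>1) \<triangleleft> b \<ominus>\<^bsub>A\<^esub> a\<^sub>2 \<otimes>\<^bsub>A\<^esub> (a\<^sub>1 \<triangleleft> b)"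
    and act5: "\<lbrakk>b\<^sub>1 \<in> carrier B; b\<^sub>2 \<in> carrier B; a \<in> carrier A\<rbrakk> \<Longrightarrow>
      (b\<^sub>1 \<otimes>\<^bsub>B\<^esub> b\<^sub>2) \<triangleright> a = b\<^sub>1 \<triangleright> (b\<^sub>2 \<triangleright> a) \<oplus>\<^bsub>A\<^esub> b\<^sub>1 \<triangleright> (a \<triangleleft> b\<^sub>2) \<ominus>\<^bsub>A\<^esub> (b\<^sub>1 \<triangleright> a) \<triangleleft> b\<^sub>2"
    and act6: "\<lbrakk>b\<^sub>1 \<in> carrier B; b\<^sub>2 \<in> carrier B; a \<in> carrier A\<rbrakk> \<Longrightarrow>
      a \<triangleleft> (b\<^sub>1 \<otimes>\<^bsub>B\<^esub> b\<^sub>2) = (a \<triangleleft> b\<^sub>1) \<triangleleft> b\<^sub>2 \<oplus>\<^bsub>A\<^esub> (b\<^sub>1 \<triangleright> a) \<triangleleft> b\<^sub>2 \<ominus>\<^bsub>A\<^esub> b\<^sub>1 \<triangleright> (a \<triangleleft> b\<^sub>2)"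
    and act7: "\<lbrakk>b\<^sub>1 \<in> carrier B; b\<^sub>2 \<in> carrier B; a \<in> carrier A\<rbrakk> \<Longrightarrow>
      (a \<triangleleft> b\<^sub>1) \<triangleleft> b\<^sub>2 = a \<triangleleft> (b\<^sub>1 \<otimes>\<^bsub>B\<^esub> b\<^sub>2) \<oplus>\<^bsub>A\<^esub> a \<triangleleft> (b\<^sub>2 \<otimes>\<^bsub>B\<^esub> b\<^sub>1) \<ominus>\<^bsub>A\<^esub> (a \<triangleleft> b\<^sub>2) \<triangleleft> b\<^sub>1"
    and act8: "\<lbrakk>b\<^sub>1 \<in> carrier B; b\<^sub>2 \<in> carrier B; a \<in> carrier A\<rbrakk> \<Longrightarrow>
      b\<^sub>1 \<triangleright> (b\<^sub>2 \<triangleright> a) = (b\<^sub>1 \<otimes>\<^bsub>B\<^esub> b\<^sub>2) \<triangleright> a \<oplus>\<^bsub>A\<^esub> (b\<^sub>2 \<otimes>\<^bsub>B\<^esub> b\<^sub>1) \<triangleright> a \<ominus>\<^bsub>A\<^esub> b\<^sub>2 \<triangleright> (b\<^sub>1 \<triangleright> a)"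

text \<open>
  A pair \<open>f\<close> of maps on \<open>A\<close> has \<open>fa = fst f a\<close> and \<open>af = snd f a\<close>. The maps are restricted to
  the carrier (value \<^const>\<open>undefined\<close> outside), so that pairs giving the same maps are equal.
\<close>

type_synonym 'a pair = "('a \<Rightarrow> 'a) \<times> ('a \<Rightarrow> 'a)"

definition action_pair ::
    "('f, 'a, 'm) module_scheme \<Rightarrow> ('b \<Rightarrow> 'a \<Rightarrow> 'a) \<Rightarrow> ('a \<Rightarrow> 'b \<Rightarrow> 'a) \<Rightarrow> 'b \<Rightarrow> 'a pair" where
  "action_pair A l r b = (\<lambda>a \<in> carrier A. l b a, \<lambda>a \<in> carrier A. r a b)"

definition pair_zero :: "('f, 'a, 'm) module_scheme \<Rightarrow> 'a pair" where
  "pair_zero A = (\<lambda>a \<in> carrier A. \<zero>\<^bsub>A\<^esub>, \<lambda>a \<in> carrier A. \<zero>\<^bsub>A\<^esub>)"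

definition pair_add :: "('f, 'a, 'm) module_scheme \<Rightarrow> 'a pair \<Rightarrow> 'a pair \<Rightarrow> 'a pair" where
  "pair_add A f g =
     (\<lambda>a \<in> carrier A. fst f a \<oplus>\<^bsub>A\<^esub> fst g a, \<lambda>a \<in> carrier A. snd f a \<oplus>\<^bsub>A\<^esub> snd g a)"

definition pair_neg :: "('f, 'a, 'm) module_scheme \<Rightarrow> 'a pair \<Rightarrow> 'a pair" where
  "pair_neg A f = (\<lambda>a \<in> carrier A. \<ominus>\<^bsub>A\<^esub> fst f a, \<lambda>a \<in> carrier A. \<ominus>\<^bsub>A\<^esub> snd f a)"

definition pair_smult :: "('f, 'a, 'm) module_scheme \<Rightarrow> 'f \<Rightarrow> 'a pair \<Rightarrow> 'a pair" where
  "pair_smult A c f =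
     (\<lambda>a \<in> carrier A. c \<odot>\<^bsub>A\<^esub> fst f a, \<lambda>a \<in> carrier A. c \<odot>\<^bsub>A\<^esub> snd f a)"

text \<open>\<open>(fg)a = f(ga) + f(ag) - (fa)g\<close> and \<open>a(fg) = (af)g + (fa)g - f(ag)\<close>.\<close>

definition pair_mult :: "('f, 'a, 'm) module_scheme \<Rightarrow> 'a pair \<Rightarrow> 'a pair \<Rightarrow> 'a pair" where
  "pair_mult A f g =
     (\<lambda>a \<in> carrier A. fst f (fst g a) \<oplus>\<^bsub>A\<^esub> fst f (snd g a) \<ominus>\<^bsub>A\<^esub> snd g (fst f a),
      \<lambda>a \<in> carrier A. snd g (snd f a) \<oplus>\<^bsub>A\<^esub> snd g (fst f a) \<ominus>\<^bsub>A\<^esub> fst f (snd g a))"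

definition pair_algebra ::
    "('f, 'a, 'm) module_scheme \<Rightarrow> 'a pair set \<Rightarrow> ('f, 'a pair) module" where
  "pair_algebra A S =
     \<lparr>carrier = S, mult = pair_mult A, one = undefined, zero = pair_zero A, add = pair_add A,
      smult = pair_smult A\<rparr>"

text \<open>
  The pairs given by the elements of all g-alternative algebras with a derived action on \<open>A\<close>.
  A definition cannot quantify over types, so \<open>B\<close> ranges over the algebras carried by sets of
  elements of type \<^typ>\<open>'a pair\<close>. This loses nothing: by the lemma \<open>action_pair_in_BB\<close> below, the
  pairs given by a derived action of an algebra of any type already belong to \<open>BB F A\<close>, since the
  image of \<open>B\<close> among the pairs is again a g-alternative algebra with a derived action on \<open>A\<close>.
\<close>

definition BB :: "('f, 'r) ring_scheme \<Rightarrow> ('f, 'a, 'm) module_scheme \<Rightarrow> 'a pair set" where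
  "BB F A =
     {action_pair A l r b |(B :: ('f, 'a pair) module) l r b.
        derived_action F B A l r \<and> b \<in> carrier B}"

inductive_set usga_carrier ::
    "('f, 'r) ring_scheme \<Rightarrow> ('f, 'a, 'm) module_scheme \<Rightarrow> 'a pair set"
  for F :: "('f, 'r) ring_scheme" and A :: "('f, 'a, 'm) module_scheme" where
  base: "f \<in> BB F A \<Longrightarrow> f \<in> usga_carrier F A"
| add: "\<lbrakk>f \<in> usga_carrier F A; g \<in> usga_carrier F A\<rbrakk> \<Longrightarrow> pair_add A f g \<in> usga_carrier F A"
| neg: "f \<in> usga_carrier F A \<Longrightarrow> pair_neg A f \<in> usga_carrier F A"
| mult: "\<lbrakk>f \<in> usga_carrier F A; g \<in> usga_carrier F A\<rbrakk> \<Longrightarrow> pair_mult A f g \<in> usga_carrier F A"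

definition usga ::
    "('f, 'r) ring_scheme \<Rightarrow> ('f, 'a, 'm) module_scheme \<Rightarrow> ('f, 'a pair) module" where
  "usga F A = pair_algebra A (usga_carrier F A)"

definition usga_substructure ::
    "('f, 'r) ring_scheme \<Rightarrow> ('f, 'a, 'm) module_scheme \<Rightarrow> 'a set \<Rightarrow> bool" where
  "usga_substructure F A S \<longleftrightarrow>
     submodule S F A \<and> (\<forall>x \<in> S. \<forall>y \<in> S. x \<otimes>\<^bsub>A\<^esub> y \<in> S) \<and>
     (\<forall>f \<in> carrier (usga F A). \<forall>a \<in> S. fst f a \<in> S \<and> snd f a \<in> S)"

text \<open>
  The elements \<open>x(yz) + x(zy)\<close> and \<open>(yz)x + (zy)x\<close> with one of \<open>x\<close>, \<open>y\<close>, \<open>z\<close> in some \<open>B\<^sub>i\<close>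
  and the other two in \<open>A\<close>. Such an element depends on the entry from \<open>B\<^sub>i\<close> only through the
  pair \<open>b\<close> of maps it gives.
\<close>

inductive_set soci_gens ::
    "('f, 'r) ring_scheme \<Rightarrow> ('f, 'a, 'm) module_scheme \<Rightarrow> 'a set"
  for F :: "('f, 'r) ring_scheme" and A :: "('f, 'a, 'm) module_scheme" where
  x_left: "\<lbrakk>b \<in> BB F A; y \<in> carrier A; z \<in> carrier A\<rbrakk> \<Longrightarrow>
    fst b (y \<otimes>\<^bsub>A\<^esub> z) \<oplus>\<^bsub>A\<^esub> fst b (z \<otimes>\<^bsub>A\<^esub> y) \<in> soci_gens F A"
| x_right: "\<lbrakk>b \<in> BB F A; y \<in> carrier A; z \<in> carrier A\<rbrakk> \<Longrightarrow>
    snd b (y \<otimes>\<^bsub>A\<^esub> z) \<oplus>\<^bsub>A\<^esub> snd b (z \<otimes>\<^bsub>A\<^esub> y) \<in> soci_gens F A"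
| y_left: "\<lbrakk>x \<in> carrier A; b \<in> BB F A; z \<in> carrier A\<rbrakk> \<Longrightarrow>
    x \<otimes>\<^bsub>A\<^esub> fst b z \<oplus>\<^bsub>A\<^esub> x \<otimes>\<^bsub>A\<^esub> snd b z \<in> soci_gens F A"
| y_right: "\<lbrakk>x \<in> carrier A; b \<in> BB F A; z \<in> carrier A\<rbrakk> \<Longrightarrow>
    fst b z \<otimes>\<^bsub>A\<^esub> x \<oplus>\<^bsub>A\<^esub> snd b z \<otimes>\<^bsub>A\<^esub> x \<in> soci_gens F A"
| z_left: "\<lbrakk>x \<in> carrier A; y \<in> carrier A; b \<in> BB F A\<rbrakk> \<Longrightarrow>
    x \<otimes>\<^bsub>A\<^esub> snd b y \<oplus>\<^bsub>A\<^esub> x \<otimes>\<^bsub>A\<^esub> fst b y \<in> soci_gens F A"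
| z_right: "\<lbrakk>x \<in> carrier A; y \<in> carrier A; b \<in> BB F A\<rbrakk> \<Longrightarrow>
    snd b y \<otimes>\<^bsub>A\<^esub> x \<oplus>\<^bsub>A\<^esub> fst b y \<otimes>\<^bsub>A\<^esub> x \<in> soci_gens F A"

definition soci :: "('f, 'r) ring_scheme \<Rightarrow> ('f, 'a, 'm) module_scheme \<Rightarrow> 'a set" where
  "soci F A = \<Inter> {S. usga_substructure F A S \<and> soci_gens F A \<subseteq> S}"

definition asoci_n :: "('f, 'r) ring_scheme \<Rightarrow> ('f, 'a, 'm) module_scheme \<Rightarrow> nat \<Rightarrow> 'a set" where
  "asoci_n F A n =
     {x \<in> carrier A. \<forall>as. set as \<subseteq> carrier A \<and> length as = n \<longrightarrow>
        foldl (\<lambda>u a. u \<otimes>\<^bsub>A\<^esub> a) x as \<in> soci F A}"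

definition asoci :: "('f, 'r) ring_scheme \<Rightarrow> ('f, 'a, 'm) module_scheme \<Rightarrow> 'a set" where
  "asoci F A = (\<Union>n \<in> {1..}. asoci_n F A n)"


lemma derived_action_image:
  fixes F :: "('f, 'r) ring_scheme"
    and B :: "('f, 'b, 'n) module_scheme"
    and A :: "('f, 'a, 'm) module_scheme"
  assumes "derived_action F B A l r"
  shows "derived_action F (pair_algebra A (action_pair A l r ` carrier B)) A
           (\<lambda>f a. fst f a) (\<lambda>a f. snd f a)"
proof -
  interpret derived_action F B A l r by (rule assms)
  define P where "P = action_pair A l r"
  define I where "I = pair_algebra A (P ` carrier B)"
  have Bm: "b \<otimes>\<^bsub>B\<^esub> b' \<in> carrier B" if "b \<in> carrier B" "b' \<in> carrier B" for b b'
    using B.mult_bilinear that unfolding bilinear_op_def by blast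
  have lc: "l b a \<in> carrier A" if "b \<in> carrier B" "a \<in> carrier A" for b a
    using lact_bilinear that unfolding bilinear_op_def by blast
  have rc: "r a b \<in> carrier A" if "b \<in> carrier B" "a \<in> carrier A" for b a
    using ract_bilinear that unfolding bilinear_op_def by blast
  have fP: "fst (P b) a = l b a" "snd (P b) a = r a b" if "a \<in> carrier A" for b a
    using that by (simp_all add: P_def action_pair_def)
  have Padd: "P (b \<oplus>\<^bsub>B\<^esub> b') = pair_add A (P b) (P b')"
    if "b \<in> carrier B" "b' \<in> carrier B" for b b'
    using lact_bilinear ract_bilinear that
    unfolding P_def action_pair_def pair_add_def bilinear_op_def
    by (auto simp: restrict_def fun_eq_iff)
  have Psm: "P (c \<odot>\<^bsub>B\<^esub> b) = pair_smult A c (P b)"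
    if "c \<in> carrier F" "b \<in> carrier B" for c b
    using lact_bilinear ract_bilinear that
    unfolding P_def action_pair_def pair_smult_def bilinear_op_def
    by (auto simp: restrict_def fun_eq_iff)
  have Pmult: "P (b \<otimes>\<^bsub>B\<^esub> b') = pair_mult A (P b) (P b')"
    if "b \<in> carrier B" "b' \<in> carrier B" for b b'
    using act5[OF that] act6[OF that] that
    by (auto simp: restrict_def fun_eq_iff P_def action_pair_def pair_mult_def lc rc)
  have Pzero: "P \<zero>\<^bsub>B\<^esub> = pair_zero A"
  proof -
    have "l \<zero>\<^bsub>B\<^esub> a = \<zero>\<^bsub>A\<^esub> \<and> r a \<zero>\<^bsub>B\<^esub> = \<zero>\<^bsub>A\<^esub>" if a: "a \<in> carrier A" for a
    proof -
      have "l (\<zero>\<^bsub>F\<^esub> \<odot>\<^bsub>B\<^esub> \<zero>\<^bsub>B\<^esub>) a = \<zero>\<^bsub>F\<^esub> \<odot>\<^bsub>A\<^esub> l \<zero>\<^bsub>B\<^esub> a"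
        "r a (\<zero>\<^bsub>F\<^esub> \<odot>\<^bsub>B\<^esub> \<zero>\<^bsub>B\<^esub>) = \<zero>\<^bsub>F\<^esub> \<odot>\<^bsub>A\<^esub> r a \<zero>\<^bsub>B\<^esub>"
        using lact_bilinear ract_bilinear a B.zero_closed B.F.zero_closed
        unfolding bilinear_op_def by blast+
      then show ?thesis using a by (simp add: lc rc)
    qed
    then show ?thesis
      by (auto simp: restrict_def fun_eq_iff P_def action_pair_def pair_zero_def)
  qed
  have sel: "carrier I = P ` carrier B" "add I = pair_add A" "mult I = pair_mult A"
    "smult I = pair_smult A" "zero I = pair_zero A"
    by (simp_all add: I_def pair_algebra_def)
  have hom: "P b \<oplus>\<^bsub>I\<^esub> P b' = P (b \<oplus>\<^bsub>B\<^esub> b')" "P b \<otimes>\<^bsub>I\<^esub> P b' = P (b \<otimes>\<^bsub>B\<^esub> b')"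
    if "b \<in> carrier B" "b' \<in> carrier B" for b b'
    using that by (simp_all add: sel Padd Pmult)
  have homs: "c \<odot>\<^bsub>I\<^esub> P b = P (c \<odot>\<^bsub>B\<^esub> b)" if "c \<in> carrier F" "b \<in> carrier B" for c b
    using that by (simp add: sel Psm)
  have hom0: "\<zero>\<^bsub>I\<^esub> = P \<zero>\<^bsub>B\<^esub>" by (simp add: sel Pzero)
  have ab: "abelian_group I"
  proof (rule abelian_groupI)
    fix x assume "x \<in> carrier I"
    then obtain b where b: "b \<in> carrier B" "x = P b" by (auto simp: sel)
    have "P (\<ominus>\<^bsub>B\<^esub> b) \<in> carrier I" using b by (auto simp: sel)
    moreover have "P (\<ominus>\<^bsub>B\<^esub> b) \<oplus>\<^bsub>I\<^esub> x = \<zero>\<^bsub>I\<^esub>" using b by (simp add: hom hom0 B.M.l_neg)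
    ultimately show "\<exists>y\<in>carrier I. y \<oplus>\<^bsub>I\<^esub> x = \<zero>\<^bsub>I\<^esub>" by blast
  qed (auto simp: sel(1) hom hom0 B.M.a_ac)
  interpret Ig: abelian_group I by (rule ab)
  have mi: "P b \<ominus>\<^bsub>I\<^esub> P b' = P (b \<ominus>\<^bsub>B\<^esub> b')" if "b \<in> carrier B" "b' \<in> carrier B" for b b'
  proof -
    have "P (\<ominus>\<^bsub>B\<^esub> b') \<oplus>\<^bsub>I\<^esub> P b' = \<zero>\<^bsub>I\<^esub>" using that by (simp add: hom hom0 B.M.l_neg)
    then have "\<ominus>\<^bsub>I\<^esub> P b' = P (\<ominus>\<^bsub>B\<^esub> b')"
      using that by (intro Ig.minus_equality) (auto simp: sel(1))
    then show ?thesis using that by (simp add: a_minus_def hom)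
  qed
  have mod: "module F I"
    by (rule moduleI)
      (auto simp: sel(1) hom homs B.smult_l_distr B.smult_r_distr B.smult_assoc1
        intro: ab B.F.is_cring)
  have bil: "bilinear_op F I I I (\<lambda>x y. x \<otimes>\<^bsub>I\<^esub> y)"
    using B.mult_bilinear unfolding bilinear_op_def
    by (auto simp: sel(1) hom homs Bm)
  have gI: "g_alternative F I"
  proof (intro g_alternative.intro nonassoc_algebra.intro nonassoc_algebra_axioms.intro
      g_alternative_axioms.intro)
    show "field F" by (rule B.F.field_axioms)
  next
    fix x y z assume "x \<in> carrier I" "y \<in> carrier I" "z \<in> carrier I"
    then obtain a b c where *: "a \<in> carrier B" "b \<in> carrier B" "c \<in> carrier B"
      "x = P a" "y = P b" "z = P c" by (auto simp: sel(1))
    show "x \<otimes>\<^bsub>I\<^esub> (y \<otimes>\<^bsub>I\<^esub> z) = x \<otimes>\<^bsub>I\<^esub> y \<otimes>\<^bsub>I\<^esub> z \<oplus>\<^bsub>I\<^esub> y \<otimes>\<^bsub>I\<^esub> x \<otimes>\<^bsub>I\<^esub> z \<ominus>\<^bsub>I\<^esub> y \<otimes>\<^bsub>I\<^esub> (x \<otimes>\<^bsub>I\<^esub> z)"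
      using * B.g_alt_left[of a b c] by (simp add: hom mi Bm)
    show "x \<otimes>\<^bsub>I\<^esub> y \<otimes>\<^bsub>I\<^esub> z = x \<otimes>\<^bsub>I\<^esub> (y \<otimes>\<^bsub>I\<^esub> z) \<oplus>\<^bsub>I\<^esub> x \<otimes>\<^bsub>I\<^esub> (z \<otimes>\<^bsub>I\<^esub> y) \<ominus>\<^bsub>I\<^esub> x \<otimes>\<^bsub>I\<^esub> z \<otimes>\<^bsub>I\<^esub> y"
      using * B.g_alt_right[of a b c] by (simp add: hom mi Bm)
  qed (rule mod bil)+
  have Am: "x \<otimes>\<^bsub>A\<^esub> y \<in> carrier A" if "x \<in> carrier A" "y \<in> carrier A" for x y
    using A.mult_bilinear that unfolding bilinear_op_def by blast
  have "derived_action F I A (\<lambda>f a. fst f a) (\<lambda>a f. snd f a)"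
  proof (intro derived_action.intro derived_action_axioms.intro)
    show "bilinear_op F I A A (\<lambda>f a. fst f a)"
      using lact_bilinear unfolding bilinear_op_def
      by (auto simp: sel(1) hom homs fP)
    show "bilinear_op F A I A (\<lambda>a f. snd f a)"
      using ract_bilinear unfolding bilinear_op_def
      by (auto simp: sel(1) hom homs fP)
  qed (rule gI A.g_alternative_axioms |
      (auto simp: sel(1) hom fP lc rc Am Bm intro: act1 act2 act3 act4 act5 act6 act7 act8; fail))+
  then show ?thesis by (simp add: I_def P_def)
qed

lemma action_pair_in_BB:
  fixes F :: "('f, 'r) ring_scheme"
    and B :: "('f, 'b, 'n) module_scheme"
    and A :: "('f, 'a, 'm) module_scheme"
  assumes "derived_action F B A l r" and "b \<in> carrier B"
  shows "action_pair A l r b \<in> BB F A"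
proof -
  let ?I = "pair_algebra A (action_pair A l r ` carrier B)"
  let ?p = "action_pair A l r b"
  have "?p \<in> carrier ?I" using assms(2) by (simp add: pair_algebra_def)
  moreover have "?p = action_pair A (\<lambda>f a. fst f a) (\<lambda>a f. snd f a) ?p"
    by (simp add: action_pair_def restrict_def fun_eq_iff)
  ultimately show ?thesis
    unfolding BB_def using derived_action_image[OF assms(1)] by blast
qed

end

theory Submission
  imports Defs
begin

text \<open>
  \<open>Soci(A)\<close> is stable under right multiplication by \<open>A\<close>, hence lies in \<open>Asoci(A)\<close>; so the
  hypothesis says that \<open>Soci(A) = 0\<close> and that no nonzero element of \<open>A\<close> annihilates \<open>A\<close> from the
  left. Cancelling a right factor in the generators of \<open>Soci(A)\<close> gives \<open>ab = -ba\<close> for all \<open>b\<close> in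
  \<open>BB F A\<close>, in particular for \<open>b\<close> in \<open>A\<close>, and the derived action identities become
  \<open>b(xy) = -(bx)y = -x(by)\<close>. Therefore \<open>x(y(zw)) = (yz)(xw) = y(x(zw))\<close>, but also
  \<open>x(y(zw)) = -y(x(zw))\<close>, so \<open>x(y(z(2w))) = 0\<close> and, cancelling, \<open>2A = 0\<close>. All signs disappear:
  every element of \<open>usga F A\<close> is a linear map \<open>f\<close> with \<open>f(xy) = (fx)y = x(fy)\<close>, any two such maps
  commute, and their product in \<open>usga F A\<close> is composition. The identities to be proved are then trivial.
\<close>

section \<open>Linear maps of a module into itself\<close>

text \<open>The extensional function space \<open>\<rightarrow>\<^sub>E\<close> makes the maps
  \<open>undefined\<close> off the carrier, like the components of the pairs, so maps that agree on
  the carrier are equal.\<close>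

definition linear_op ::
    "('f, 'r) ring_scheme \<Rightarrow> ('f, 'a, 'm) module_scheme \<Rightarrow> ('a \<Rightarrow> 'a) \<Rightarrow> bool" where
  "linear_op F A h \<longleftrightarrow> h \<in> carrier A \<rightarrow>\<^sub>E carrier A \<and>
     (\<forall>x \<in> carrier A. \<forall>y \<in> carrier A. h (x \<oplus>\<^bsub>A\<^esub> y) = h x \<oplus>\<^bsub>A\<^esub> h y) \<and>
     (\<forall>c \<in> carrier F. \<forall>x \<in> carrier A. h (c \<odot>\<^bsub>A\<^esub> x) = c \<odot>\<^bsub>A\<^esub> h x)"

lemma linear_op_closed: "linear_op F A h \<Longrightarrow> x \<in> carrier A \<Longrightarrow> h x \<in> carrier A"
  unfolding linear_op_def by blast

lemma linear_op_add:
  "linear_op F A h \<Longrightarrow> x \<in> carrier A \<Longrightarrow> y \<in> carrier A \<Longrightarrow> h (x \<oplus>\<^bsub>A\<^esub> y) = h x \<oplus>\<^bsub>A\<^esub> h y"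
  unfolding linear_op_def by blast

lemma linear_op_smult:
  "linear_op F A h \<Longrightarrow> c \<in> carrier F \<Longrightarrow> x \<in> carrier A \<Longrightarrow> h (c \<odot>\<^bsub>A\<^esub> x) = c \<odot>\<^bsub>A\<^esub> h x"
  unfolding linear_op_def by blast

lemma linear_op_restrict: "linear_op F A h \<Longrightarrow> restrict h (carrier A) = h"
  unfolding linear_op_def by (blast intro: PiE_restrict)

lemma linear_opI:
  assumes "\<And>x. x \<in> carrier A \<Longrightarrow> h x \<in> carrier A"
    and "\<And>x y. \<lbrakk>x \<in> carrier A; y \<in> carrier A\<rbrakk> \<Longrightarrow> h (x \<oplus>\<^bsub>A\<^esub> y) = h x \<oplus>\<^bsub>A\<^esub> h y"
    and "\<And>c x. \<lbrakk>c \<in> carrier F; x \<in> carrier A\<rbrakk> \<Longrightarrow> h (c \<odot>\<^bsub>A\<^esub> x) = c \<odot>\<^bsub>A\<^esub> h x"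
    and "\<And>x. x \<notin> carrier A \<Longrightarrow> h x = undefined"
  shows "linear_op F A h"
  unfolding linear_op_def by (blast intro: assms)

lemma (in module) linear_op_zero:
  assumes "linear_op R M h"
  shows "h \<zero>\<^bsub>M\<^esub> = \<zero>\<^bsub>M\<^esub>"
proof -
  have "h \<zero>\<^bsub>M\<^esub> \<in> carrier M" and "h (\<zero>\<^bsub>M\<^esub> \<oplus>\<^bsub>M\<^esub> \<zero>\<^bsub>M\<^esub>) = h \<zero>\<^bsub>M\<^esub> \<oplus>\<^bsub>M\<^esub> h \<zero>\<^bsub>M\<^esub>"
    using assms by (blast intro: linear_op_closed linear_op_add)+
  then show ?thesis by simp
qed

lemma (in module) linear_op_minus:
  assumes "linear_op R M h" "x \<in> carrier M"
  shows "h (\<ominus>\<^bsub>M\<^esub> x) = \<ominus>\<^bsub>M\<^esub> h x"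
proof -
  have "h (\<ominus>\<^bsub>M\<^esub> x) \<oplus>\<^bsub>M\<^esub> h x = \<zero>\<^bsub>M\<^esub>"
    using assms by (simp add: linear_op_add[symmetric, OF assms(1)] M.l_neg linear_op_zero)
  then show ?thesis
    using assms by (metis M.minus_equality linear_op_closed M.a_inv_closed)
qed

lemma (in module) linear_op_pointwise_add:
  assumes "linear_op R M g" "linear_op R M h"
  shows "linear_op R M (\<lambda>a\<in>carrier M. g a \<oplus>\<^bsub>M\<^esub> h a)"
  by (rule linear_opI)
    (simp_all add: assms[THEN linear_op_closed] assms[THEN linear_op_add]
      assms[THEN linear_op_smult] M.a_ac smult_r_distr)

lemma (in module) linear_op_pointwise_minus:
  assumes "linear_op R M h"
  shows "linear_op R M (\<lambda>a\<in>carrier M. \<ominus>\<^bsub>M\<^esub> h a)"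
  by (rule linear_opI)
    (simp_all add: assms[THEN linear_op_closed] assms[THEN linear_op_add]
      assms[THEN linear_op_smult] M.minus_add smult_r_minus)

lemma (in module) linear_op_comp:
  assumes "linear_op R M g" "linear_op R M h"
  shows "linear_op R M (\<lambda>a\<in>carrier M. g (h a))"
  by (rule linear_opI)
    (simp_all add: assms[THEN linear_op_closed] assms[THEN linear_op_add]
      assms[THEN linear_op_smult])

text \<open>Both components of \<open>pair_mult\<close> have this shape, with composites as the
  three maps.\<close>

lemma (in module) linear_op_pointwise_combination:
  assumes "linear_op R M f" "linear_op R M g" "linear_op R M h"
  shows "linear_op R M (\<lambda>a\<in>carrier M. f a \<oplus>\<^bsub>M\<^esub> g a \<ominus>\<^bsub>M\<^esub> h a)"
proof -
  have "(\<lambda>a\<in>carrier M. f a \<oplus>\<^bsub>M\<^esub> g a \<ominus>\<^bsub>M\<^esub> h a) =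
    (\<lambda>a\<in>carrier M. (\<lambda>a\<in>carrier M. f a \<oplus>\<^bsub>M\<^esub> g a) a \<oplus>\<^bsub>M\<^esub> (\<lambda>a\<in>carrier M. \<ominus>\<^bsub>M\<^esub> h a) a)"
    by (auto simp: a_minus_def)
  then show ?thesis
    by (simp only: linear_op_pointwise_add linear_op_pointwise_minus assms)
qed

section \<open>Left and right multiplications as linear maps\<close>

context nonassoc_algebra
begin

lemma mult_closed: "x \<in> carrier A \<Longrightarrow> y \<in> carrier A \<Longrightarrow> x \<otimes>\<^bsub>A\<^esub> y \<in> carrier A"
  using mult_bilinear unfolding bilinear_op_def by blast

lemma linear_op_mult_left:
  "x \<in> carrier A \<Longrightarrow> linear_op F A (\<lambda>y\<in>carrier A. x \<otimes>\<^bsub>A\<^esub> y)"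
  using mult_bilinear unfolding bilinear_op_def linear_op_def by auto

lemma linear_op_mult_right:
  "x \<in> carrier A \<Longrightarrow> linear_op F A (\<lambda>y\<in>carrier A. y \<otimes>\<^bsub>A\<^esub> x)"
  using mult_bilinear unfolding bilinear_op_def linear_op_def by auto

lemma mult_add_right:
  "\<lbrakk>x \<in> carrier A; y \<in> carrier A; z \<in> carrier A\<rbrakk> \<Longrightarrow>
    x \<otimes>\<^bsub>A\<^esub> (y \<oplus>\<^bsub>A\<^esub> z) = x \<otimes>\<^bsub>A\<^esub> y \<oplus>\<^bsub>A\<^esub> x \<otimes>\<^bsub>A\<^esub> z"
  using mult_bilinear unfolding bilinear_op_def by blast

lemma mult_add_left:
  "\<lbrakk>x \<in> carrier A; y \<in> carrier A; z \<in> carrier A\<rbrakk> \<Longrightarrow>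
    (x \<oplus>\<^bsub>A\<^esub> y) \<otimes>\<^bsub>A\<^esub> z = x \<otimes>\<^bsub>A\<^esub> z \<oplus>\<^bsub>A\<^esub> y \<otimes>\<^bsub>A\<^esub> z"
  using mult_bilinear unfolding bilinear_op_def by blast

lemma mult_minus_right:
  "x \<in> carrier A \<Longrightarrow> y \<in> carrier A \<Longrightarrow> x \<otimes>\<^bsub>A\<^esub> (\<ominus>\<^bsub>A\<^esub> y) = \<ominus>\<^bsub>A\<^esub> (x \<otimes>\<^bsub>A\<^esub> y)"
  using linear_op_minus[OF linear_op_mult_left, of x y] by simp

lemma mult_minus_left:
  "x \<in> carrier A \<Longrightarrow> y \<in> carrier A \<Longrightarrow> (\<ominus>\<^bsub>A\<^esub> y) \<otimes>\<^bsub>A\<^esub> x = \<ominus>\<^bsub>A\<^esub> (y \<otimes>\<^bsub>A\<^esub> x)"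
  using linear_op_minus[OF linear_op_mult_right, of x y] by simp

end

section \<open>Pairs of maps that come from derived actions\<close>

lemma BB_E:
  fixes A :: "('f, 'a, 'm) module_scheme"
  assumes "b \<in> BB F A"
  obtains B :: "('f, 'a pair) module" and l r b' where "derived_action F B A l r"
    "b' \<in> carrier B" "b = action_pair A l r b'"
  using assms unfolding BB_def mem_Collect_eq by (elim exE conjE) (rule that)

lemma BB_linear_op:
  fixes A :: "('f, 'a, 'm) module_scheme"
  assumes "b \<in> BB F A"
  shows "linear_op F A (fst b)" and "linear_op F A (snd b)"
proof -
  from assms obtain B :: "('f, 'a pair) module" and l r b' where
    "derived_action F B A l r" and b: "b' \<in> carrier B" "b = action_pair A l r b'"
    by (rule BB_E)
  then interpret derived_action F B A l r by blast
  show "linear_op F A (fst b)" "linear_op F A (snd b)"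
    using b lact_bilinear ract_bilinear
    unfolding linear_op_def bilinear_op_def action_pair_def
    by auto
qed

text \<open>These are \<open>act1\<close> and \<open>act3\<close>, freed from the algebra that
  induces the pair; \<open>BB_mult\<close> is drawn from them.\<close>

lemma BB_act:
  fixes A :: "('f, 'a, 'm) module_scheme"
  assumes "b \<in> BB F A" "x \<in> carrier A" "y \<in> carrier A"
  shows "fst b (x \<otimes>\<^bsub>A\<^esub> y) =
      fst b x \<otimes>\<^bsub>A\<^esub> y \<oplus>\<^bsub>A\<^esub> snd b x \<otimes>\<^bsub>A\<^esub> y \<ominus>\<^bsub>A\<^esub> x \<otimes>\<^bsub>A\<^esub> fst b y"
    and "fst b x \<otimes>\<^bsub>A\<^esub> y =
      fst b (x \<otimes>\<^bsub>A\<^esub> y) \<oplus>\<^bsub>A\<^esub> fst b (y \<otimes>\<^bsub>A\<^esub> x) \<ominus>\<^bsub>A\<^esub> fst b y \<otimes>\<^bsub>A\<^esub> x"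
proof -
  from assms obtain B :: "('f, 'a pair) module" and l r b' where
    "derived_action F B A l r" and b: "b' \<in> carrier B" "b = action_pair A l r b'"
    by (blast elim: BB_E)
  then interpret derived_action F B A l r by blast
  show "fst b (x \<otimes>\<^bsub>A\<^esub> y) =
      fst b x \<otimes>\<^bsub>A\<^esub> y \<oplus>\<^bsub>A\<^esub> snd b x \<otimes>\<^bsub>A\<^esub> y \<ominus>\<^bsub>A\<^esub> x \<otimes>\<^bsub>A\<^esub> fst b y"
    "fst b x \<otimes>\<^bsub>A\<^esub> y =
      fst b (x \<otimes>\<^bsub>A\<^esub> y) \<oplus>\<^bsub>A\<^esub> fst b (y \<otimes>\<^bsub>A\<^esub> x) \<ominus>\<^bsub>A\<^esub> fst b y \<otimes>\<^bsub>A\<^esub> x"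
    using act1[of b' x y] act3[of b' x y] assms(2,3) b
    by (simp_all add: action_pair_def A.mult_closed)
qed

text \<open>The scalar is absorbed into the acting element, by bilinearity of the action.\<close>

lemma BB_smult:
  fixes A :: "('f, 'a, 'm) module_scheme"
  assumes "b \<in> BB F A" "c \<in> carrier F"
  shows "pair_smult A c b \<in> BB F A"
proof -
  from assms obtain B :: "('f, 'a pair) module" and l r b' where
    d: "derived_action F B A l r" and b: "b' \<in> carrier B" "b = action_pair A l r b'"
    by (blast elim: BB_E)
  then interpret derived_action F B A l r by blast
  have "pair_smult A c b = action_pair A l r (c \<odot>\<^bsub>B\<^esub> b')"
    using b assms(2) lact_bilinear ract_bilinear
    unfolding pair_smult_def action_pair_def bilinear_op_def
    by (auto simp: restrict_def fun_eq_iff)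
  then show ?thesis
    using action_pair_in_BB[OF d, of "c \<odot>\<^bsub>B\<^esub> b'"] b assms(2) by simp
qed

section \<open>Soci(A) and Asoci(A) in a g-alternative algebra\<close>

context g_alternative
begin

text \<open>For \<open>B = A\<close> each of the eight identities is an instance of one of the two
  g-alternative laws.\<close>

lemma derived_action_self: "derived_action F A A (\<lambda>x y. x \<otimes>\<^bsub>A\<^esub> y) (\<lambda>x y. x \<otimes>\<^bsub>A\<^esub> y)"
  by (intro derived_action.intro derived_action_axioms.intro g_alternative_axioms mult_bilinear
      g_alt_left g_alt_right)

text \<open>Every statement about \<open>BB F A\<close> thereby specialises to multiplication in
  \<open>A\<close>. The elements of \<open>A\<close> are not of the type over which
  \<open>BB\<close> ranges, which is why \<open>action_pair_in_BB\<close> is invoked.\<close>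

lemma mult_pair_in_BB:
  "a \<in> carrier A \<Longrightarrow> (\<lambda>x\<in>carrier A. a \<otimes>\<^bsub>A\<^esub> x, \<lambda>x\<in>carrier A. x \<otimes>\<^bsub>A\<^esub> a) \<in> BB F A"
  using action_pair_in_BB[OF derived_action_self] by (simp add: action_pair_def)

lemma usga_linear_op:
  "f \<in> usga_carrier F A \<Longrightarrow> linear_op F A (fst f) \<and> linear_op F A (snd f)"
proof (induction rule: usga_carrier.induct)
  case (mult f g)
  \<comment> \<open>Each summand is written as a restricted map, the form in which the lemmas on
    linear maps apply.\<close>
  have e: "pair_mult A f g =
    (\<lambda>a\<in>carrier A. (\<lambda>a\<in>carrier A. fst f (fst g a)) a \<oplus>\<^bsub>A\<^esub> (\<lambda>a\<in>carrier A. fst f (snd g a)) a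
        \<ominus>\<^bsub>A\<^esub> (\<lambda>a\<in>carrier A. snd g (fst f a)) a,
     \<lambda>a\<in>carrier A. (\<lambda>a\<in>carrier A. snd g (snd f a)) a \<oplus>\<^bsub>A\<^esub> (\<lambda>a\<in>carrier A. snd g (fst f a)) a
        \<ominus>\<^bsub>A\<^esub> (\<lambda>a\<in>carrier A. fst f (snd g a)) a)"
    unfolding pair_mult_def by (simp cong: restrict_cong)
  show ?case
    unfolding e fst_conv snd_conv
    by (intro conjI linear_op_pointwise_combination linear_op_comp) (use mult in auto)
next
  case (add f g)
  then show ?case
    unfolding pair_add_def fst_conv snd_conv by (intro conjI linear_op_pointwise_add) blast+
next
  case (neg f)
  then show ?case
    unfolding pair_neg_def fst_conv snd_conv by (intro conjI linear_op_pointwise_minus) blast+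
qed (simp add: BB_linear_op)

lemma BB_closed:
  "b \<in> BB F A \<Longrightarrow> x \<in> carrier A \<Longrightarrow> fst b x \<in> carrier A"
  "b \<in> BB F A \<Longrightarrow> x \<in> carrier A \<Longrightarrow> snd b x \<in> carrier A"
  by (simp_all add: BB_linear_op linear_op_closed[of F])

lemma soci_gens_closed: "soci_gens F A \<subseteq> carrier A"
proof
  fix x assume "x \<in> soci_gens F A"
  then show "x \<in> carrier A"
    by cases (simp_all add: BB_closed mult_closed)
qed

text \<open>Shows that the intersection defining \<open>soci\<close> runs over a nonempty family and
  so stays inside the carrier.\<close>

lemma carrier_substructure: "usga_substructure F A (carrier A)"
proof -
  have "submodule (carrier A) F A"
    by (rule module.submoduleI[OF module_axioms]) auto
  moreover have "fst f a \<in> carrier A \<and> snd f a \<in> carrier A"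
    if "f \<in> usga_carrier F A" "a \<in> carrier A" for f a
    using usga_linear_op[OF that(1)] that(2) by (blast intro: linear_op_closed)
  ultimately show ?thesis
    unfolding usga_substructure_def by (simp add: mult_closed usga_def pair_algebra_def)
qed

lemma soci_closed: "soci F A \<subseteq> carrier A"
  unfolding soci_def using carrier_substructure soci_gens_closed by blast

lemma soci_zero: "\<zero>\<^bsub>A\<^esub> \<in> soci F A"
  unfolding soci_def usga_substructure_def
  by (auto dest!: submodule.axioms(1) dest: subgroup.one_closed)

text \<open>A substructure is closed under products of its own elements; an arbitrary factor
  \<open>a\<close> is covered because right multiplication by \<open>a\<close> is the second
  component of a pair in \<open>usga F A\<close>.\<close>

lemma soci_mult_right:
  assumes "x \<in> soci F A" "a \<in> carrier A"
  shows "x \<otimes>\<^bsub>A\<^esub> a \<in> soci F A"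
proof -
  have "x \<otimes>\<^bsub>A\<^esub> a \<in> S" if S: "usga_substructure F A S" "soci_gens F A \<subseteq> S" for S
  proof -
    have "x \<in> S" using assms S unfolding soci_def by blast
    moreover have "(\<lambda>x\<in>carrier A. a \<otimes>\<^bsub>A\<^esub> x, \<lambda>x\<in>carrier A. x \<otimes>\<^bsub>A\<^esub> a) \<in> carrier (usga F A)"
      by (simp add: usga_def pair_algebra_def usga_carrier.base mult_pair_in_BB assms)
    ultimately have "(\<lambda>x\<in>carrier A. x \<otimes>\<^bsub>A\<^esub> a) x \<in> S"
      using S(1) unfolding usga_substructure_def by (metis snd_conv)
    then show ?thesis
      using soci_closed assms by auto
  qed
  then show ?thesis unfolding soci_def by blast
qed

text \<open>Only the layer \<open>n = 1\<close> is involved, where the lists of factors have length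
  one.\<close>

lemma asoci_1I:
  assumes "x \<in> carrier A" "\<And>a. a \<in> carrier A \<Longrightarrow> x \<otimes>\<^bsub>A\<^esub> a \<in> soci F A"
  shows "x \<in> asoci F A"
proof -
  have "x \<in> asoci_n F A 1"
    using assms unfolding asoci_n_def by (auto simp: length_Suc_conv)
  then show ?thesis unfolding asoci_def by auto
qed

end

section \<open>Consequences of Asoci(A) = 0: cancellation, signs, and
  \<open>w \<oplus> w = \<zero>\<close>\<close>

locale asoci_zero_algebra = g_alternative F A for F (structure) and A (structure) +
  assumes asoci_zero: "asoci F A = {\<zero>\<^bsub>A\<^esub>}"
begin

lemma soci_gen_zero:
  assumes "x \<in> soci_gens F A"
  shows "x = \<zero>\<^bsub>A\<^esub>"
proof -
  have "x \<in> soci F A"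
    using assms unfolding soci_def by blast
  then have "x \<in> asoci F A"
    using soci_closed by (auto intro: asoci_1I soci_mult_right)
  then show ?thesis by (simp add: asoci_zero)
qed

text \<open>All products of \<open>x\<close> with elements of \<open>A\<close> are zero, hence in
  \<open>soci F A\<close>, so \<open>x\<close> lies in \<open>asoci F A\<close>.\<close>

lemma annihilator_zero:
  assumes "x \<in> carrier A" "\<And>a. a \<in> carrier A \<Longrightarrow> x \<otimes>\<^bsub>A\<^esub> a = \<zero>\<^bsub>A\<^esub>"
  shows "x = \<zero>\<^bsub>A\<^esub>"
  using asoci_1I[of x] assms soci_zero by (auto simp: asoci_zero)

lemma mult_right_cancel:
  assumes "x \<in> carrier A" "y \<in> carrier A" "\<And>a. a \<in> carrier A \<Longrightarrow> x \<otimes>\<^bsub>A\<^esub> a = y \<otimes>\<^bsub>A\<^esub> a"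
  shows "x = y"
proof -
  have "x \<ominus>\<^bsub>A\<^esub> y = \<zero>\<^bsub>A\<^esub>"
    by (rule annihilator_zero)
      (simp_all add: assms a_minus_def mult_add_left mult_minus_left M.r_neg mult_closed)
  then show ?thesis using assms(1,2) by (metis M.minus_equality M.minus_minus M.a_inv_closed a_minus_def)
qed

text \<open>By left distributivity the generator \<open>z_right\<close> is the product of
  \<open>snd b z \<oplus> fst b z\<close> with an arbitrary \<open>x\<close>; since it vanishes,
  \<open>annihilator_zero\<close> applies.\<close>

lemma BB_anticommute:
  assumes "b \<in> BB F A" "z \<in> carrier A"
  shows "snd b z = \<ominus>\<^bsub>A\<^esub> fst b z"
proof -
  have "snd b z \<oplus>\<^bsub>A\<^esub> fst b z = \<zero>\<^bsub>A\<^esub>"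
  proof (rule annihilator_zero)
    fix x assume x: "x \<in> carrier A"
    show "(snd b z \<oplus>\<^bsub>A\<^esub> fst b z) \<otimes>\<^bsub>A\<^esub> x = \<zero>\<^bsub>A\<^esub>"
      using soci_gen_zero[OF soci_gens.z_right[OF x assms(2,1)]] x assms
      by (simp add: mult_add_left BB_closed)
  qed (simp add: assms BB_closed)
  then show ?thesis
    using assms by (metis M.minus_equality BB_closed)
qed

lemma anticommute:
  assumes "x \<in> carrier A" "y \<in> carrier A"
  shows "y \<otimes>\<^bsub>A\<^esub> x = \<ominus>\<^bsub>A\<^esub> (x \<otimes>\<^bsub>A\<^esub> y)"
  using BB_anticommute[OF mult_pair_in_BB[OF assms(1)] assms(2)] assms by simp

text \<open>As \<open>snd b\<close> is the negative of \<open>fst b\<close>, the first two terms on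
  the right of \<open>act1\<close> cancel. In \<open>act3\<close> the first two cancel by
  anticommutativity of \<open>A\<close>, which also turns the remaining term into the stated
  one.\<close>

lemma BB_mult:
  assumes "b \<in> BB F A" "x \<in> carrier A" "y \<in> carrier A"
  shows "fst b (x \<otimes>\<^bsub>A\<^esub> y) = \<ominus>\<^bsub>A\<^esub> (x \<otimes>\<^bsub>A\<^esub> fst b y)"
    and "fst b x \<otimes>\<^bsub>A\<^esub> y = x \<otimes>\<^bsub>A\<^esub> fst b y"
proof -
  note c = BB_closed[OF assms(1)] mult_closed
  show "fst b (x \<otimes>\<^bsub>A\<^esub> y) = \<ominus>\<^bsub>A\<^esub> (x \<otimes>\<^bsub>A\<^esub> fst b y)"
    using BB_act(1)[OF assms] assms
    by (simp add: BB_anticommute mult_minus_left c a_minus_def M.r_neg)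
  have "fst b (y \<otimes>\<^bsub>A\<^esub> x) = \<ominus>\<^bsub>A\<^esub> fst b (x \<otimes>\<^bsub>A\<^esub> y)"
    using assms by (simp add: anticommute[of x y] linear_op_minus BB_linear_op mult_closed)
  moreover have "fst b y \<otimes>\<^bsub>A\<^esub> x = \<ominus>\<^bsub>A\<^esub> (x \<otimes>\<^bsub>A\<^esub> fst b y)"
    using assms by (intro anticommute) (simp_all add: c)
  ultimately show "fst b x \<otimes>\<^bsub>A\<^esub> y = x \<otimes>\<^bsub>A\<^esub> fst b y"
    using BB_act(2)[OF assms] assms by (simp add: c a_minus_def M.r_neg)
qed

text \<open>This is \<open>BB_mult\<close> for the pair of multiplications by \<open>x\<close>: left
  multiplications anticommute.\<close>

lemma mult_left_commute_minus:
  assumes "x \<in> carrier A" "y \<in> carrier A" "z \<in> carrier A"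
  shows "x \<otimes>\<^bsub>A\<^esub> (y \<otimes>\<^bsub>A\<^esub> z) = \<ominus>\<^bsub>A\<^esub> (y \<otimes>\<^bsub>A\<^esub> (x \<otimes>\<^bsub>A\<^esub> z))"
    and "(x \<otimes>\<^bsub>A\<^esub> y) \<otimes>\<^bsub>A\<^esub> z = y \<otimes>\<^bsub>A\<^esub> (x \<otimes>\<^bsub>A\<^esub> z)"
  using BB_mult[OF mult_pair_in_BB[OF assms(1)] assms(2,3)] assms by (simp_all add: mult_closed)

lemma left_annihilated_zero:
  assumes "u \<in> carrier A" "\<And>x. x \<in> carrier A \<Longrightarrow> x \<otimes>\<^bsub>A\<^esub> u = \<zero>\<^bsub>A\<^esub>"
  shows "u = \<zero>\<^bsub>A\<^esub>"
proof (rule annihilator_zero)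
  fix x assume x: "x \<in> carrier A"
  show "u \<otimes>\<^bsub>A\<^esub> x = \<zero>\<^bsub>A\<^esub>"
    unfolding anticommute[OF x assms(1)] by (simp add: assms(2) x)
qed (rule assms(1))

lemma double_zero:
  assumes w: "w \<in> carrier A"
  shows "w \<oplus>\<^bsub>A\<^esub> w = \<zero>\<^bsub>A\<^esub>"
\<comment> \<open>Three nested cancellations reduce the claim to the vanishing of
  \<open>w \<oplus> w\<close> multiplied on the left by \<open>z\<close>, then \<open>y\<close>,
  then \<open>x\<close>.\<close>
proof (rule left_annihilated_zero[OF _ left_annihilated_zero[OF _ left_annihilated_zero]])
  fix x y z assume xyz: "z \<in> carrier A" "y \<in> carrier A" "x \<in> carrier A"
  let ?p = "x \<otimes>\<^bsub>A\<^esub> (y \<otimes>\<^bsub>A\<^esub> (z \<otimes>\<^bsub>A\<^esub> w))" and ?q = "y \<otimes>\<^bsub>A\<^esub> (x \<otimes>\<^bsub>A\<^esub> (z \<otimes>\<^bsub>A\<^esub> w))"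
  note c = xyz w mult_closed
  \<comment> \<open>Multiplying by \<open>z\<close> and then by \<open>y\<close> is, up to sign,
    multiplying by their product, so \<open>x\<close> can be moved past both factors at
    once.\<close>
  have "?p = \<ominus>\<^bsub>A\<^esub> (x \<otimes>\<^bsub>A\<^esub> ((y \<otimes>\<^bsub>A\<^esub> z) \<otimes>\<^bsub>A\<^esub> w))"
    using mult_left_commute_minus(1)[of y z w] mult_left_commute_minus(2)[of y z w]
    by (simp add: c mult_minus_right)
  also have "\<dots> = (y \<otimes>\<^bsub>A\<^esub> z) \<otimes>\<^bsub>A\<^esub> (x \<otimes>\<^bsub>A\<^esub> w)"
    using mult_left_commute_minus(1)[of x "y \<otimes>\<^bsub>A\<^esub> z" w] by (simp add: c)
  also have "\<dots> = z \<otimes>\<^bsub>A\<^esub> (y \<otimes>\<^bsub>A\<^esub> (x \<otimes>\<^bsub>A\<^esub> w))"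
    using mult_left_commute_minus(2)[of y z "x \<otimes>\<^bsub>A\<^esub> w"] by (simp add: c)
  also have "\<dots> = \<ominus>\<^bsub>A\<^esub> (y \<otimes>\<^bsub>A\<^esub> (z \<otimes>\<^bsub>A\<^esub> (x \<otimes>\<^bsub>A\<^esub> w)))"
    using mult_left_commute_minus(1)[of z y "x \<otimes>\<^bsub>A\<^esub> w"] by (simp add: c)
  also have "\<dots> = ?q"
    using mult_left_commute_minus(1)[of x z w] by (simp add: c mult_minus_right)
  finally have "?p = ?q" .
  \<comment> \<open>Exchanging \<open>x\<close> and \<open>y\<close> directly costs one sign, while
    the signs of the detour cancel.\<close>
  moreover have "?p = \<ominus>\<^bsub>A\<^esub> ?q"
    using mult_left_commute_minus(1)[of x y "z \<otimes>\<^bsub>A\<^esub> w"] by (simp add: c)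
  ultimately have "?p \<oplus>\<^bsub>A\<^esub> ?p = \<zero>\<^bsub>A\<^esub>"
    by (metis M.r_neg c)
  then show "x \<otimes>\<^bsub>A\<^esub> (y \<otimes>\<^bsub>A\<^esub> (z \<otimes>\<^bsub>A\<^esub> (w \<oplus>\<^bsub>A\<^esub> w))) = \<zero>\<^bsub>A\<^esub>"
    by (simp add: c mult_add_right)
qed (simp_all add: w mult_closed)

lemma minus_self: "w \<in> carrier A \<Longrightarrow> \<ominus>\<^bsub>A\<^esub> w = w"
  using M.minus_equality double_zero by blast

section \<open>Multipliers of \<open>A\<close>\<close>

text \<open>A multiplier is a pair whose two components are the same element of the centroid of
  \<open>A\<close>.\<close>

definition multiplier where
  "multiplier f \<longleftrightarrow> linear_op F A (fst f) \<and> snd f = fst f \<and>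
     (\<forall>x\<in>carrier A. \<forall>y\<in>carrier A.
        fst f (x \<otimes>\<^bsub>A\<^esub> y) = x \<otimes>\<^bsub>A\<^esub> fst f y \<and> fst f x \<otimes>\<^bsub>A\<^esub> y = x \<otimes>\<^bsub>A\<^esub> fst f y)"

lemma multiplier_linear: "multiplier f \<Longrightarrow> linear_op F A (fst f)"
  and multiplier_snd: "multiplier f \<Longrightarrow> snd f = fst f"
  and multiplier_mult:
    "\<lbrakk>multiplier f; x \<in> carrier A; y \<in> carrier A\<rbrakk> \<Longrightarrow> fst f (x \<otimes>\<^bsub>A\<^esub> y) = x \<otimes>\<^bsub>A\<^esub> fst f y"
    "\<lbrakk>multiplier f; x \<in> carrier A; y \<in> carrier A\<rbrakk> \<Longrightarrow> fst f x \<otimes>\<^bsub>A\<^esub> y = x \<otimes>\<^bsub>A\<^esub> fst f y"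
  unfolding multiplier_def by blast+

lemma multiplier_closed: "multiplier f \<Longrightarrow> x \<in> carrier A \<Longrightarrow> fst f x \<in> carrier A"
  by (blast intro: linear_op_closed multiplier_linear)

text \<open>On a product each of the two maps can be moved to either factor, so they commute there;
  the auxiliary right factor \<open>x\<close> is then cancelled.\<close>

lemma multiplier_commute:
  assumes "multiplier f" "multiplier g" "a \<in> carrier A"
  shows "fst f (fst g a) = fst g (fst f a)"
proof (rule mult_right_cancel)
  fix x assume x: "x \<in> carrier A"
  note m = multiplier_mult[OF assms(1)] multiplier_mult[OF assms(2)]
  note c = multiplier_closed assms x
  have "fst f (fst g a) \<otimes>\<^bsub>A\<^esub> x = a \<otimes>\<^bsub>A\<^esub> fst g (fst f x)"
    by (simp add: m c)
  also have "\<dots> = fst g a \<otimes>\<^bsub>A\<^esub> fst f x"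
    by (simp add: m c)
  also have "\<dots> = fst f (fst g a \<otimes>\<^bsub>A\<^esub> x)"
    by (intro m(1)[symmetric] c)
  also have "\<dots> = a \<otimes>\<^bsub>A\<^esub> fst f (fst g x)"
    by (simp add: m c)
  also have "\<dots> = fst g (fst f a) \<otimes>\<^bsub>A\<^esub> x"
    by (simp add: m c)
  finally show "fst f (fst g a) \<otimes>\<^bsub>A\<^esub> x = fst g (fst f a) \<otimes>\<^bsub>A\<^esub> x" .
qed (simp_all add: multiplier_closed assms)

text \<open>All three summands of each component equal \<open>fst f (fst g a)\<close>, and two of
  them cancel since \<open>A\<close> has no signs.\<close>

lemma pair_mult_multiplier:
  assumes "multiplier f" "multiplier g"
  shows "pair_mult A f g =
    (\<lambda>a\<in>carrier A. fst f (fst g a), \<lambda>a\<in>carrier A. fst f (fst g a))"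
  unfolding pair_mult_def using assms
  by (auto simp: multiplier_snd multiplier_commute[of g f] a_minus_def minus_self double_zero
      multiplier_closed intro!: restrict_ext)

lemma BB_multiplier:
  assumes "b \<in> BB F A"
  shows "multiplier b"
proof -
  have "snd b = fst b"
  proof
    fix x
    \<comment> \<open>On the carrier this is anticommutation without the sign; outside it both
      values are \<open>undefined\<close>.\<close>
    show "snd b x = fst b x"
      using assms BB_linear_op[OF assms]
      by (cases "x \<in> carrier A")
        (simp_all add: BB_anticommute minus_self BB_closed linear_op_def PiE_def extensional_def)
  qed
  then show ?thesis
    unfolding multiplier_def using BB_linear_op[OF assms] BB_mult[OF assms] assms
    by (simp add: minus_self mult_closed BB_closed)
qed

text \<open>For the product, passing a composite from one factor to the other reverses its order, so
  \<open>multiplier_commute\<close> is what restores it.\<close>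

lemma usga_multiplier: "f \<in> usga_carrier F A \<Longrightarrow> multiplier f"
proof (induction rule: usga_carrier.induct)
  case (base f)
  then show ?case by (rule BB_multiplier)
next
  case (add f g)
  then show ?case
    using usga_linear_op[OF usga_carrier.add, of f g]
    \<comment> \<open>Unfolding at the new pair only leaves \<open>f\<close> and \<open>g\<close>
      accessible to the rules for multipliers.\<close>
    unfolding multiplier_def[of "pair_add A f g"]
    by (auto simp: pair_add_def multiplier_snd multiplier_mult multiplier_closed mult_closed
        mult_add_left mult_add_right)
next
  case (neg f)
  then show ?case
    using usga_linear_op[OF usga_carrier.neg, of f]
    unfolding multiplier_def[of "pair_neg A f"]
    by (auto simp: pair_neg_def multiplier_snd multiplier_mult multiplier_closed mult_closed
        minus_self)
next
  case (mult f g)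
  then show ?case
    using usga_linear_op[OF usga_carrier.mult, of f g]
    unfolding multiplier_def[of "pair_mult A f g"]
    by (auto simp: pair_mult_multiplier multiplier_mult multiplier_closed mult_closed
        multiplier_commute[of g f])
qed

section \<open>The module and algebra structure of \<open>usga F A\<close>\<close>

text \<open>Scalars are not among the generating operations of \<open>usga_carrier\<close>. They are
  absorbed by \<open>BB_smult\<close> at the base, and in a product by its left factor.\<close>

lemma usga_smult:
  assumes "c \<in> carrier F"
  shows "f \<in> usga_carrier F A \<Longrightarrow> pair_smult A c f \<in> usga_carrier F A"
proof (induction rule: usga_carrier.induct)
  case (base f)
  then show ?case by (intro usga_carrier.base BB_smult assms)
next
  case (add f g)
  have "pair_smult A c (pair_add A f g) = pair_add A (pair_smult A c f) (pair_smult A c g)"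
    using usga_linear_op[OF add.hyps(1)] usga_linear_op[OF add.hyps(2)] assms
    by (auto simp: pair_smult_def pair_add_def smult_r_distr linear_op_closed intro!: restrict_ext)
  then show ?case using add.IH by (simp add: usga_carrier.add)
next
  case (neg f)
  have "pair_smult A c (pair_neg A f) = pair_neg A (pair_smult A c f)"
    using usga_linear_op[OF neg.hyps] assms
    by (auto simp: pair_smult_def pair_neg_def smult_r_minus linear_op_closed intro!: restrict_ext)
  then show ?case using neg.IH by (simp add: usga_carrier.neg)
next
  case (mult f g)
  \<comment> \<open>The induction hypothesis puts the scaled pair in
    \<open>usga_carrier F A\<close>, so both products below are compositions.\<close>
  have m: "multiplier f" "multiplier g" "multiplier (pair_smult A c f)"
    using usga_multiplier mult by blast+
  have "pair_smult A c (pair_mult A f g) = pair_mult A (pair_smult A c f) g"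
    unfolding pair_mult_multiplier[OF m(1,2)] pair_mult_multiplier[OF m(3,2)]
    by (auto simp: pair_smult_def multiplier_closed m intro!: restrict_ext)
  then show ?case using mult by (simp add: usga_carrier.mult)
qed

text \<open>Through this, equations in \<open>usga F A\<close> become pointwise equations between
  first components.\<close>

lemma multiplier_eqI:
  assumes "multiplier f" "multiplier g" "\<And>a. a \<in> carrier A \<Longrightarrow> fst f a = fst g a"
  shows "f = g"
proof -
  have "fst f = fst g"
  proof -
    have "restrict (fst f) (carrier A) = restrict (fst g) (carrier A)"
      by (rule restrict_ext) (rule assms)
    then show ?thesis
      by (simp only: linear_op_restrict[OF multiplier_linear] assms(1,2))
  qed
  then show ?thesis
    using assms by (simp add: prod_eq_iff multiplier_snd)
qed

text \<open>Zero is not a generating operation either; the zero pair arises from the zero of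
  \<open>A\<close> acting on \<open>A\<close>.\<close>

lemma usga_pair_zero: "pair_zero A \<in> usga_carrier F A"
proof -
  have z: "x \<otimes>\<^bsub>A\<^esub> \<zero>\<^bsub>A\<^esub> = \<zero>\<^bsub>A\<^esub>" "\<zero>\<^bsub>A\<^esub> \<otimes>\<^bsub>A\<^esub> x = \<zero>\<^bsub>A\<^esub>" if "x \<in> carrier A" for x
    using linear_op_zero[OF linear_op_mult_left[OF that]]
      linear_op_zero[OF linear_op_mult_right[OF that]] by simp_all
  have "pair_zero A = (\<lambda>x\<in>carrier A. \<zero>\<^bsub>A\<^esub> \<otimes>\<^bsub>A\<^esub> x, \<lambda>x\<in>carrier A. x \<otimes>\<^bsub>A\<^esub> \<zero>\<^bsub>A\<^esub>)"
    unfolding pair_zero_def by (auto simp: z intro!: restrict_ext)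
  then show ?thesis
    using mult_pair_in_BB[of "\<zero>\<^bsub>A\<^esub>"] by (simp add: usga_carrier.base)
qed

lemma usga_sel:
  "carrier (usga F A) = usga_carrier F A" "add (usga F A) = pair_add A"
  "mult (usga F A) = pair_mult A" "smult (usga F A) = pair_smult A"
  "zero (usga F A) = pair_zero A"
  by (simp_all add: usga_def pair_algebra_def)

lemma usga_eqI:
  assumes "f \<in> usga_carrier F A" "g \<in> usga_carrier F A"
    "\<And>a. a \<in> carrier A \<Longrightarrow> fst f a = fst g a"
  shows "f = g"
  using assms by (intro multiplier_eqI usga_multiplier)

lemma fst_pair:
  assumes "a \<in> carrier A"
  shows "fst (pair_add A f g) a = fst f a \<oplus>\<^bsub>A\<^esub> fst g a"
    "fst (pair_smult A c f) a = c \<odot>\<^bsub>A\<^esub> fst f a"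
    "fst (pair_neg A f) a = \<ominus>\<^bsub>A\<^esub> fst f a"
    "fst (pair_zero A) a = \<zero>\<^bsub>A\<^esub>"
    "f \<in> usga_carrier F A \<Longrightarrow> g \<in> usga_carrier F A \<Longrightarrow>
      fst (pair_mult A f g) a = fst f (fst g a)"
  using assms
  by (simp_all add: pair_add_def pair_smult_def pair_neg_def pair_zero_def
      pair_mult_multiplier usga_multiplier)

lemma usga_fst_closed:
  "f \<in> usga_carrier F A \<Longrightarrow> x \<in> carrier A \<Longrightarrow> fst f x \<in> carrier A"
  by (blast intro: multiplier_closed usga_multiplier)

lemma usga_fst_linear:
  "\<lbrakk>f \<in> usga_carrier F A; x \<in> carrier A; y \<in> carrier A\<rbrakk> \<Longrightarrow>
    fst f (x \<oplus>\<^bsub>A\<^esub> y) = fst f x \<oplus>\<^bsub>A\<^esub> fst f y"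
  "\<lbrakk>f \<in> usga_carrier F A; c \<in> carrier F; x \<in> carrier A\<rbrakk> \<Longrightarrow>
    fst f (c \<odot>\<^bsub>A\<^esub> x) = c \<odot>\<^bsub>A\<^esub> fst f x"
  by (blast dest: usga_linear_op intro: linear_op_add linear_op_smult)+

lemmas usga_closed = usga_carrier.add usga_carrier.neg usga_carrier.mult usga_smult usga_pair_zero
  usga_fst_closed

lemma usga_abelian_group: "abelian_group (usga F A)"
proof (rule abelian_groupI)
  fix f assume "f \<in> carrier (usga F A)"
  then have "pair_neg A f \<in> carrier (usga F A)" "pair_neg A f \<oplus>\<^bsub>usga F A\<^esub> f = \<zero>\<^bsub>usga F A\<^esub>"
    by (auto simp: usga_sel usga_closed fst_pair M.l_neg intro!: usga_eqI)
  then show "\<exists>g\<in>carrier (usga F A). g \<oplus>\<^bsub>usga F A\<^esub> f = \<zero>\<^bsub>usga F A\<^esub>" by blast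
qed (simp_all add: usga_sel usga_closed, (rule usga_eqI; simp add: usga_closed fst_pair M.a_ac)+)

lemma usga_module: "module F (usga F A)"
  by (rule moduleI[OF F.is_cring usga_abelian_group])
    (simp_all add: usga_sel usga_closed, (rule usga_eqI;
      simp add: usga_closed fst_pair smult_l_distr smult_r_distr smult_assoc1)+)

lemma usga_minus:
  assumes "f \<in> usga_carrier F A" "g \<in> usga_carrier F A"
  shows "f \<ominus>\<^bsub>usga F A\<^esub> g = pair_add A f g"
proof -
  interpret U: abelian_group "usga F A" by (rule usga_abelian_group)
  have "g \<oplus>\<^bsub>usga F A\<^esub> g = \<zero>\<^bsub>usga F A\<^esub>"
    using assms by (auto simp: usga_sel usga_closed fst_pair double_zero intro!: usga_eqI)
  then have "\<ominus>\<^bsub>usga F A\<^esub> g = g"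
    using assms by (intro U.minus_equality) (simp_all add: usga_sel)
  then show ?thesis by (simp add: a_minus_def usga_sel)
qed

text \<open>Once subtraction is addition and the composites are put in one order, both g-alternative
  laws in \<open>usga F A\<close> take this form.\<close>

lemma add_minus_self: "x \<in> carrier A \<Longrightarrow> x \<oplus>\<^bsub>A\<^esub> x \<oplus>\<^bsub>A\<^esub> x = x"
  by (simp add: double_zero)

lemma usga_g_alternative: "g_alternative F (usga F A)"
proof (intro g_alternative.intro nonassoc_algebra.intro nonassoc_algebra_axioms.intro
      g_alternative_axioms.intro)
  show "field F" by (rule F.field_axioms)
  show "module F (usga F A)" by (rule usga_module)
  show "bilinear_op F (usga F A) (usga F A) (usga F A) (\<lambda>x y. x \<otimes>\<^bsub>usga F A\<^esub> y)"
    unfolding bilinear_op_def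
    by (intro conjI ballI; simp add: usga_sel usga_closed;
        rule usga_eqI; simp add: usga_closed fst_pair usga_fst_linear)
next
  fix f g h assume "f \<in> carrier (usga F A)" "g \<in> carrier (usga F A)" "h \<in> carrier (usga F A)"
  then have c: "f \<in> usga_carrier F A" "g \<in> usga_carrier F A" "h \<in> usga_carrier F A"
    by (simp_all add: usga_sel)
  \<comment> \<open>As rewrite rules these sort every composite of the three maps, with
    \<open>h\<close> outermost and \<open>f\<close> innermost.\<close>
  have comm: "fst f (fst g a) = fst g (fst f a)" "fst g (fst h a) = fst h (fst g a)"
    "fst f (fst h a) = fst h (fst f a)"
    if "a \<in> carrier A" for a
    using that c by (simp_all add: multiplier_commute usga_multiplier)
  show "f \<otimes>\<^bsub>usga F A\<^esub> (g \<otimes>\<^bsub>usga F A\<^esub> h) =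
    f \<otimes>\<^bsub>usga F A\<^esub> g \<otimes>\<^bsub>usga F A\<^esub> h \<oplus>\<^bsub>usga F A\<^esub> g \<otimes>\<^bsub>usga F A\<^esub> f \<otimes>\<^bsub>usga F A\<^esub> h
      \<ominus>\<^bsub>usga F A\<^esub> g \<otimes>\<^bsub>usga F A\<^esub> (f \<otimes>\<^bsub>usga F A\<^esub> h)"
    by (simp add: usga_minus usga_sel usga_closed c, rule usga_eqI)
      (simp_all add: usga_closed c fst_pair comm add_minus_self)
  show "f \<otimes>\<^bsub>usga F A\<^esub> g \<otimes>\<^bsub>usga F A\<^esub> h =
    f \<otimes>\<^bsub>usga F A\<^esub> (g \<otimes>\<^bsub>usga F A\<^esub> h) \<oplus>\<^bsub>usga F A\<^esub> f \<otimes>\<^bsub>usga F A\<^esub> (h \<otimes>\<^bsub>usga F A\<^esub> g)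
      \<ominus>\<^bsub>usga F A\<^esub> f \<otimes>\<^bsub>usga F A\<^esub> h \<otimes>\<^bsub>usga F A\<^esub> g"
    by (simp add: usga_minus usga_sel usga_closed c, rule usga_eqI)
      (simp_all add: usga_closed c fst_pair comm add_minus_self)
qed

section \<open>The derived action of \<open>usga F A\<close> on \<open>A\<close>\<close>

text \<open>All terms of an identity have one common value, \<open>x \<otimes> fst f y\<close> for
  two elements of \<open>A\<close> and \<open>fst f (fst g a)\<close> for two of
  \<open>usga F A\<close>; \<open>two\<close> then closes it.\<close>

lemma usga_derived_action: "derived_action F (usga F A) A (\<lambda>f a. fst f a) (\<lambda>a f. snd f a)"
proof -
  have sn: "snd f = fst f" if "f \<in> usga_carrier F A" for f
    using that by (blast intro: multiplier_snd usga_multiplier)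
  have cA: "y \<otimes>\<^bsub>A\<^esub> x = x \<otimes>\<^bsub>A\<^esub> y" if "x \<in> carrier A" "y \<in> carrier A" for x y
    using that by (simp add: anticommute[of x y] minus_self mult_closed)
  have m: "fst f (x \<otimes>\<^bsub>A\<^esub> y) = x \<otimes>\<^bsub>A\<^esub> fst f y" "fst f x \<otimes>\<^bsub>A\<^esub> y = x \<otimes>\<^bsub>A\<^esub> fst f y"
    if "f \<in> usga_carrier F A" "x \<in> carrier A" "y \<in> carrier A" for f x y
    using that by (simp_all add: multiplier_mult usga_multiplier)
  have two: "x \<oplus>\<^bsub>A\<^esub> x \<ominus>\<^bsub>A\<^esub> x = x" if "x \<in> carrier A" for x
    using that by (simp add: a_minus_def minus_self double_zero)
  have prod: "fst f (y \<otimes>\<^bsub>A\<^esub> x) = x \<otimes>\<^bsub>A\<^esub> fst f y" "y \<otimes>\<^bsub>A\<^esub> fst f x = x \<otimes>\<^bsub>A\<^esub> fst f y"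
    if "f \<in> usga_carrier F A" "x \<in> carrier A" "y \<in> carrier A" for f x y
  proof -
    show "fst f (y \<otimes>\<^bsub>A\<^esub> x) = x \<otimes>\<^bsub>A\<^esub> fst f y"
      using m(1)[OF that] by (simp only: cA that)
    then show "y \<otimes>\<^bsub>A\<^esub> fst f x = x \<otimes>\<^bsub>A\<^esub> fst f y"
      using m(1)[OF that(1,3,2)] by simp
  qed
  have comm: "fst g (fst f a) = fst f (fst g a)"
    if "f \<in> usga_carrier F A" "g \<in> usga_carrier F A" "a \<in> carrier A" for f g a
    using that by (simp add: multiplier_commute usga_multiplier)
  show ?thesis
  proof (intro derived_action.intro derived_action_axioms.intro usga_g_alternative
      g_alternative_axioms)
    show "bilinear_op F (usga F A) A A (\<lambda>f a. fst f a)"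
      unfolding bilinear_op_def
      by (auto simp: usga_sel usga_closed fst_pair usga_fst_linear)
    show "bilinear_op F A (usga F A) A (\<lambda>a f. snd f a)"
      unfolding bilinear_op_def
      by (auto simp: usga_sel usga_closed fst_pair usga_fst_linear sn)
  next
    fix f x y assume "f \<in> carrier (usga F A)" and xy: "x \<in> carrier A" "y \<in> carrier A"
    then have f: "f \<in> usga_carrier F A" by (simp add: usga_sel)
    \<comment> \<open>Fixing \<open>x\<close> and \<open>y\<close> in \<open>prod\<close> orients
      its equations towards the common value.\<close>
    note s = sn[OF f] m[OF f] prod[OF f, of x y] two xy f usga_closed mult_closed
    show "fst f (x \<otimes>\<^bsub>A\<^esub> y) = fst f x \<otimes>\<^bsub>A\<^esub> y \<oplus>\<^bsub>A\<^esub> snd f x \<otimes>\<^bsub>A\<^esub> y \<ominus>\<^bsub>A\<^esub> x \<otimes>\<^bsub>A\<^esub> fst f y"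
      by (simp add: s)
    show "snd f (x \<otimes>\<^bsub>A\<^esub> y) = x \<otimes>\<^bsub>A\<^esub> snd f y \<oplus>\<^bsub>A\<^esub> x \<otimes>\<^bsub>A\<^esub> fst f y \<ominus>\<^bsub>A\<^esub> snd f x \<otimes>\<^bsub>A\<^esub> y"
      by (simp add: s)
    show "fst f x \<otimes>\<^bsub>A\<^esub> y = fst f (x \<otimes>\<^bsub>A\<^esub> y) \<oplus>\<^bsub>A\<^esub> fst f (y \<otimes>\<^bsub>A\<^esub> x) \<ominus>\<^bsub>A\<^esub> fst f y \<otimes>\<^bsub>A\<^esub> x"
      by (simp add: s)
    show "x \<otimes>\<^bsub>A\<^esub> snd f y = snd f (x \<otimes>\<^bsub>A\<^esub> y) \<oplus>\<^bsub>A\<^esub> snd f (y \<otimes>\<^bsub>A\<^esub> x) \<ominus>\<^bsub>A\<^esub> y \<otimes>\<^bsub>A\<^esub> snd f x"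
      by (simp add: s)
  next
    fix f g a assume "f \<in> carrier (usga F A)" "g \<in> carrier (usga F A)" and a: "a \<in> carrier A"
    then have fg: "f \<in> usga_carrier F A" "g \<in> usga_carrier F A" by (simp_all add: usga_sel)
    note s = sn fg usga_sel fst_pair comm[OF fg] two a usga_closed
    show "fst (f \<otimes>\<^bsub>usga F A\<^esub> g) a = fst f (fst g a) \<oplus>\<^bsub>A\<^esub> fst f (snd g a) \<ominus>\<^bsub>A\<^esub> snd g (fst f a)"
      by (simp add: s)
    show "snd (f \<otimes>\<^bsub>usga F A\<^esub> g) a = snd g (snd f a) \<oplus>\<^bsub>A\<^esub> snd g (fst f a) \<ominus>\<^bsub>A\<^esub> fst f (snd g a)"
      by (simp add: s)
    show "snd g (snd f a) =
        snd (f \<otimes>\<^bsub>usga F A\<^esub> g) a \<oplus>\<^bsub>A\<^esub> snd (g \<otimes>\<^bsub>usga F A\<^esub> f) a \<ominus>\<^bsub>A\<^esub> snd f (snd g a)"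
      by (simp add: s)
    show "fst f (fst g a) =
        fst (f \<otimes>\<^bsub>usga F A\<^esub> g) a \<oplus>\<^bsub>A\<^esub> fst (g \<otimes>\<^bsub>usga F A\<^esub> f) a \<ominus>\<^bsub>A\<^esub> fst g (fst f a)"
      by (simp add: s)
  qed
qed

end

theorem theorem6p1:
  fixes F :: "('f, 'r) ring_scheme" and A :: "('f, 'a, 'm) module_scheme"
  assumes "g_alternative F A"
    and "asoci F A = {\<zero>\<^bsub>A\<^esub>}"
  shows "derived_action F (usga F A) A (\<lambda>f a. fst f a) (\<lambda>a f. snd f a)"
  by (intro asoci_zero_algebra.usga_derived_action asoci_zero_algebra.intro
      asoci_zero_algebra_axioms.intro assms)

end
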